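(* Let $G=G_n$ be connected graphs on $n$ vertices with bounded degrees (maximum degree at most a constant $\Delta$ independent of $n$) and with the exponential growth property: there exists a constant $\phi>0$, independent of $n$, such that $$|B_u^r|\ge\min\left\{\exp(\phi r),\frac n2\right\}\quad\text{for all } u\in V \text{ and all integers } r\ge0 .$$ Then there exists a positive constant $C$ such that, as $n\to\infty$, for the local search allocation on $G_n$ (with ties broken uniformly at random), $$\Pr\big[X_{\max}^{(n)}\ge C\log\log n\big]\le n^{-\omega(1)} .$$
   Context: $B_u^r$ denotes the set of vertices at graph distance at most $r$ from $u$. The bound $\le n^{-\omega(1)}$ means: for every $K>0$ the probability is at most $n^{-K}$ for all sufficiently large $n$. Local search allocation on a finite, undirected, connected graph $G=(V,E)$ with $|V|=n$: the vertices are bins, all initially with load $0$. Balls $1,2,\dots$ are allocated one after another. Ball $i$ is born at a vertex $U_i$ (its birthplace), where $U_1,U_2,\dots$ are independent and uniform on $V$. Starting at $U_i$, as long as the current vertex has a neighbor whose load is strictly smaller than the load of the current vertex, the ball moves to a neighbor of smallest load; ties among the neighbors of smallest load are broken uniformly at random, independently. The search stops at the first vertex none of whose neighbors has a smaller load (a local minimum); the ball is placed there and the load of that vertex increases by $1$. $X_v^{(i)}$ is the load of $v$ right after ball $i$ is placed, and $X_{\max}^{(n)}=\max_{v\in V}X_v^{(n)}$. *)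

theory Defs
  imports
    "HOL-Probability.Probability"
    "Graph_Theory.Digraph_Component"
    "Graph_Theory.Shortest_Path"
begin

text \<open>
  A finite simple undirected graph is an instance of the locale \<open>graph\<close> of the AFP entry
  Graph_Theory, i.e. a finite loop-free digraph without parallel arcs in which every edge is
  represented by its two opposite arcs. Hence walks, distances and reachability are the undirected
  ones, and the degree of a vertex is its out-degree.
\<close>

context graph
begin

definition neighbors :: "'a \<Rightarrow> 'a set" where
  "neighbors u = {v. u \<rightarrow> v}"

text \<open>
  With every arc of cost 1, \<open>\<mu>\<close> is the graph distance (infinite between vertices that
  are not connected).
\<close>

definition dist_ball :: "'a \<Rightarrow> nat \<Rightarrow> 'a set" where
  "dist_ball u r = {v \<in> verts G. \<mu> (\<lambda>_. 1) u v \<le> ereal (real r)}"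

definition lightest_neighbors :: "('a \<Rightarrow> nat) \<Rightarrow> 'a \<Rightarrow> 'a set" where
  "lightest_neighbors X u = {v \<in> neighbors u. \<forall>w \<in> neighbors u. X v \<le> X w}"

lemma finite_neighbors: "finite (neighbors u)"
proof (rule finite_subset)
  show "neighbors u \<subseteq> verts G"
    unfolding neighbors_def by (auto simp: arcs_ends_conv)
qed simp

lemma lightest_neighbors_descent:
  assumes "w \<in> neighbors u" "X w < X u" "v \<in> set_pmf (pmf_of_set (lightest_neighbors X u))"
  shows "X v < X u"
proof -
  have fin: "finite (lightest_neighbors X u)"
    unfolding lightest_neighbors_def using finite_neighbors by simp
  obtain v0 where "is_arg_min X (\<lambda>v. v \<in> neighbors u) v0"
    using ex_is_arg_min_if_finite[OF finite_neighbors, of u X] assms(1) by blast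
  then have "v0 \<in> lightest_neighbors X u"
    unfolding lightest_neighbors_def is_arg_min_linorder by simp
  with fin have "v \<in> lightest_neighbors X u"
    using assms(3) by (metis emptyE set_pmf_of_set)
  then have "X v \<le> X w"
    using assms(1) unfolding lightest_neighbors_def by blast
  with assms(2) show ?thesis by simp
qed

text \<open>The law of the vertex at which a ball born at \<open>u\<close> is placed, given the loads \<open>X\<close>.\<close>

function local_search :: "('a \<Rightarrow> nat) \<Rightarrow> 'a \<Rightarrow> 'a pmf" where
  "local_search X u =
     (if \<exists>v \<in> neighbors u. X v < X u
      then bind_pmf (pmf_of_set (lightest_neighbors X u)) (\<lambda>v. local_search X v)
      else return_pmf u)"
  by pat_completeness auto
termination
  by (relation "Wellfounded.measure (\<lambda>(X, u). X u)") (auto dest: lightest_neighbors_descent)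

declare local_search.simps [simp del]

text \<open>
  The law of the load vector after \<open>i\<close> balls. The births and tie-breaks of different balls are
  independent, so the load vector is a Markov chain with the transition below.
\<close>

primrec allocation :: "nat \<Rightarrow> ('a \<Rightarrow> nat) pmf" where
  "allocation 0 = return_pmf (\<lambda>_. 0)"
| "allocation (Suc i) =
     bind_pmf (allocation i) (\<lambda>X.
     bind_pmf (pmf_of_set (verts G)) (\<lambda>u.
     bind_pmf (local_search X u) (\<lambda>v.
     return_pmf (X(v := X v + 1)))))"

definition max_load :: "('a \<Rightarrow> nat) \<Rightarrow> nat" where
  "max_load X = Max (X ` verts G)"

end

end

theory Submission
  imports Defs "HOL-Real_Asymp.Real_Asymp"
begin

text \<open>
  A search path strictly decreases the load at every step, so for every vertex \<open>v\<close> a ball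
  placed at \<open>x\<close> was born at some \<open>u\<close> with \<open>X u - d(v,u) \<ge> X x - d(v,x)\<close>. Give a vertex \<open>u\<close> the
  weight \<open>\<kappa> ^ min (X u - d(v,u)) H - 1\<close>: a birth at \<open>u\<close> then raises the total weight by at most
  \<open>\<kappa> - 1\<close> times the truncated power at \<open>u\<close>, and by nothing if \<open>X u < d(v,u)\<close>. As long as all loads
  are at most \<open>L\<close>, only the vertices within distance \<open>L\<close> of \<open>v\<close> matter, at most \<open>(\<Delta> + 1) ^ L\<close> of them.
  Hence after \<open>n\<close> balls the exponential moment of the total weight, scaled by about \<open>\<kappa> ^ (- H)\<close>,
  is bounded once \<open>\<kappa> ^ H \<ge> (\<Delta> + 1) ^ L\<close>, which a constant \<open>\<kappa>\<close> achieves with \<open>H = L / 2\<close>.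
  Loads of adjacent vertices differ by at most 1, so at the first time when \<open>v\<close> reaches load \<open>L\<close>
  every vertex within distance \<open>L / 4\<close> of \<open>v\<close> has full weight; for \<open>L\<close> a suitable multiple of
  \<open>ln (ln n)\<close> there are at least \<open>(ln n)\<^sup>2\<close> of these. By Markov's inequality this
  has probability \<open>exp (- \<Omega>((ln n)\<^sup>2))\<close>, which survives the union bound over \<open>v\<close> and the time.
\<close>

text \<open>Linearises the exponential of the potential increment caused by one ball, which the size
  of \<open>\<theta>\<close> keeps in the unit interval. The factor 2 reappears in
  \<open>R\<close>.\<close>

lemma exp_le_one_plus_double:
  fixes y :: real
  assumes "0 \<le> y" "y \<le> 1"
  shows "exp y \<le> 1 + 2 * y"
proof -
  have "y\<^sup>2 \<le> y" using assms by (simp add: power2_eq_square mult_left_le)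
  then show ?thesis using exp_bound[OF assms] by simp
qed

context graph
begin

section \<open>Neighbourhoods, distance balls and their growth\<close>

lemma neighbors_sym:
  assumes "w \<in> neighbors u"
  shows "u \<in> neighbors w"
  using assms graph_symmetric unfolding neighbors_def by auto

lemma neighbors_in_verts: "neighbors u \<subseteq> verts G"
  unfolding neighbors_def by (auto simp: arcs_ends_conv)

lemma card_neighbors_le: "card (neighbors u) \<le> out_degree G u"
proof -
  have "neighbors u \<subseteq> head G ` out_arcs G u"
    unfolding neighbors_def by (auto simp: arcs_ends_conv)
  then show ?thesis
    unfolding out_degree_def by (meson finite_out_arcs surj_card_le)
qed

lemma dist_ball_subset_verts: "dist_ball v r \<subseteq> verts G"
  unfolding dist_ball_def by auto

lemma finite_dist_ball: "finite (dist_ball v r)"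
  using dist_ball_subset_verts finite_verts by (rule finite_subset)

lemma dist_ball_mono: "r \<le> s \<Longrightarrow> dist_ball v r \<subseteq> dist_ball v s"
  unfolding dist_ball_def by (auto intro: order_trans)

lemma center_in_dist_ball:
  assumes "v \<in> verts G"
  shows "v \<in> dist_ball v 0"
proof -
  have "\<mu> (\<lambda>_. 1) v v \<le> ereal (awalk_cost (\<lambda>_. 1) [])"
    by (rule min_cost_le_walk_cost) (use assms in \<open>simp add: awalk_Nil_iff\<close>)
  then show ?thesis using assms unfolding dist_ball_def by (simp add: zero_ereal_def)
qed

lemma dist_ball_step:
  assumes "u \<in> dist_ball v r" "w \<in> neighbors u"
  shows "w \<in> dist_ball v (Suc r)"
proof -
  obtain e where e: "e \<in> arcs G" "arc_to_ends G e = (u, w)"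
    using assms(2) unfolding neighbors_def arcs_ends_def by auto
  have "\<mu> (\<lambda>_. 1) v w \<le> \<mu> (\<lambda>_. 1) v u + ereal 1"
    using pos_cost_mu_triangle[of "\<lambda>_. 1" e u w v] e by simp
  also have "\<dots> \<le> ereal (real r) + ereal 1"
    using assms(1) unfolding dist_ball_def by (intro add_right_mono) simp
  finally show ?thesis
    using assms(2) neighbors_in_verts unfolding dist_ball_def by (auto simp: add.commute)
qed

text \<open>Splits off the last arc of a shortest path. As \<open>r\<close> is forced to be a
  successor, radius 0 leaves at most the centre in the ball.\<close>

lemma dist_ball_last_step:
  assumes "w \<in> dist_ball v r" "w \<noteq> v"
  obtains u s where "r = Suc s" "u \<in> dist_ball v s" "w \<in> neighbors u"
proof -
  have le: "\<mu> (\<lambda>_. 1) v w \<le> ereal (real r)" and w: "w \<in> verts G"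
    using assms(1) unfolding dist_ball_def by auto
  then have "\<mu> (\<lambda>_. 1) v w < \<infinity>" by auto
  then have "v \<rightarrow>\<^sup>* w" by (simp only: \<mu>_reach_conv)
  then obtain u e where u: "\<mu> (\<lambda>_. 1) v w = \<mu> (\<lambda>_. 1) v u + ereal 1" "arc e (u, w)"
    using mu_exact_triangle[of w v "\<lambda>_. 1"] assms(2) by auto
  \<comment> \<open>Distances are extended reals here: this excludes minus infinity and makes
    \<open>r\<close> positive.\<close>
  have nonneg: "0 \<le> \<mu> (\<lambda>_. 1) v u"
    unfolding \<mu>_def by (rule INF_greatest) (auto intro: pos_cost_pos_awalk_cost)
  have "\<mu> (\<lambda>_. 1) v u + ereal 1 \<le> ereal (real r)" using le u by simp
  then have "r \<noteq> 0" and *: "\<mu> (\<lambda>_. 1) v u \<le> ereal (real r - 1)"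
    using nonneg by (cases "\<mu> (\<lambda>_. 1) v u"; auto)+
  then obtain s where s: "r = Suc s" by (cases r) auto
  have "u \<in> verts G" "w \<in> neighbors u"
    using u(2) unfolding arc_def neighbors_def arcs_ends_def by (force simp: arc_to_ends_def)+
  then show thesis
    using that[OF s] * s unfolding dist_ball_def by auto
qed

lemma card_dist_ball_le:
  assumes "\<And>u. u \<in> verts G \<Longrightarrow> out_degree G u \<le> \<Delta>"
  shows "card (dist_ball v r) \<le> (\<Delta> + 1) ^ r"
proof (induction r)
  case 0
  have "dist_ball v 0 \<subseteq> {v}" by (auto elim: dist_ball_last_step)
  then show ?case using card_mono[of "{v}"] by force
next
  case (Suc r)
  show ?case
  proof (cases "v \<in> verts G")
    case True
    have "dist_ball v (Suc r) \<subseteq> insert v (\<Union>u\<in>dist_ball v r. neighbors u)"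
      by (auto elim: dist_ball_last_step)
    then have "card (dist_ball v (Suc r)) \<le> card (insert v (\<Union>u\<in>dist_ball v r. neighbors u))"
      by (rule card_mono[rotated]) (simp add: finite_dist_ball finite_neighbors)
    also have "\<dots> \<le> 1 + card (\<Union>u\<in>dist_ball v r. neighbors u)"
      by (simp add: card_insert_le_m1 card_insert_if finite_dist_ball finite_neighbors)
    also have "card (\<Union>u\<in>dist_ball v r. neighbors u) \<le> (\<Sum>u\<in>dist_ball v r. card (neighbors u))"
      by (rule card_UN_le) (rule finite_dist_ball)
    also have "\<dots> \<le> (\<Sum>u\<in>dist_ball v r. \<Delta>)"
      using dist_ball_subset_verts assms card_neighbors_le by (intro sum_mono) (blast intro: le_trans)
    \<comment> \<open>The 1 stands for the centre; it is absorbed because the smaller ball already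
      contains \<open>v\<close>.\<close>
    also have "1 + \<dots> \<le> card (dist_ball v r) + card (dist_ball v r) * \<Delta>"
    proof -
      have "v \<in> dist_ball v r"
        using center_in_dist_ball[OF True] dist_ball_mono[of 0 r] by auto
      then have "card (dist_ball v r) > 0" using finite_dist_ball card_gt_0_iff by blast
      then show ?thesis by simp
    qed
    also have "\<dots> = (\<Delta> + 1) * card (dist_ball v r)" by simp
    also have "\<dots> \<le> (\<Delta> + 1) * (\<Delta> + 1) ^ r" using Suc.IH by (rule mult_le_mono2)
    finally show ?thesis by simp
  next
    case False
    \<comment> \<open>A vertex outside the graph reaches nothing, so its ball is empty.\<close>
    have "\<mu> (\<lambda>_. 1) v u = \<infinity>" for u
      using False by (intro shortest_path_inf) (auto dest: reachable_in_verts)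
    then show ?thesis unfolding dist_ball_def by simp
  qed
qed

section \<open>Graph distance as a natural number\<close>

text \<open>A natural number, unlike \<open>\<mu>\<close>, so that it can be subtracted from loads.
  The \<open>LEAST\<close> is meaningful once \<open>u\<close> lies in some ball around
  \<open>v\<close>, which connectedness provides.\<close>

definition hops :: "'a \<Rightarrow> 'a \<Rightarrow> nat" where
  "hops v u = (LEAST r. u \<in> dist_ball v r)"

lemma hops_le: "u \<in> dist_ball v r \<Longrightarrow> hops v u \<le> r"
  unfolding hops_def by (rule Least_le)

lemma in_dist_ball_hops:
  assumes "connected G" "v \<in> verts G" "u \<in> verts G"
  shows "u \<in> dist_ball v (hops v u)"
proof -
  have "v \<rightarrow>\<^sup>* u"
    using assms reachable_mk_symmetric_eq[OF sym_arcs]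
    unfolding connected_def strongly_connected_def by auto
  then obtain p where p: "awalk v p u" by (auto simp: reachable_awalk)
  have "awalk_cost (\<lambda>_. 1) p = real (length p)"
    by (induction p) simp_all
  then have "u \<in> dist_ball v (length p)"
    using min_cost_le_walk_cost[OF p, of "\<lambda>_. 1"] assms unfolding dist_ball_def by simp
  then show ?thesis unfolding hops_def by (rule LeastI)
qed

lemma hops_lipschitz:
  assumes "connected G" "v \<in> verts G" "w \<in> neighbors u"
  shows "hops v w \<le> Suc (hops v u)"
proof -
  have "u \<in> verts G" using assms(3) neighbors_sym neighbors_in_verts by blast
  then show ?thesis
    using assms hops_le dist_ball_step in_dist_ball_hops by blast
qed

lemma card_hops_le:
  assumes "connected G" "v \<in> verts G" "\<And>u. u \<in> verts G \<Longrightarrow> out_degree G u \<le> \<Delta>"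
  shows "card {u \<in> verts G. hops v u \<le> r} \<le> (\<Delta> + 1) ^ r"
proof -
  have "{u \<in> verts G. hops v u \<le> r} \<subseteq> dist_ball v r"
    using in_dist_ball_hops[OF assms(1,2)] dist_ball_mono by blast
  then have "card {u \<in> verts G. hops v u \<le> r} \<le> card (dist_ball v r)"
    by (rule card_mono[OF finite_dist_ball])
  also have "\<dots> \<le> (\<Delta> + 1) ^ r" using assms(3) by (rule card_dist_ball_le)
  finally show ?thesis .
qed

section \<open>Where a search ends, and smoothness of the loads\<close>

lemma lightest_neighbors_nonempty:
  assumes "w \<in> neighbors u"
  shows "lightest_neighbors X u \<noteq> {}"
proof -
  obtain v0 where "is_arg_min X (\<lambda>v. v \<in> neighbors u) v0"
    using ex_is_arg_min_if_finite[OF finite_neighbors, of u X] assms by blast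
  then show ?thesis unfolding lightest_neighbors_def is_arg_min_linorder by auto
qed

text \<open>Each step of the search lowers the load by at least 1 and \<open>f\<close> by at most 1,
  so \<open>X - f\<close>, read over the integers, never increases along the path. The choice
  \<open>f = hops v\<close> serves the potential; a constant \<open>f\<close> just gives the local
  minimum.\<close>

lemma local_search_landing:
  assumes "v \<in> set_pmf (local_search X u)" "u \<in> verts G"
    and lipschitz: "\<And>a b. b \<in> neighbors a \<Longrightarrow> f b \<le> Suc (f a)"
  shows "v \<in> verts G \<and> (\<forall>w \<in> neighbors v. X v \<le> X w) \<and> X v + f u \<le> X u + f v"
  using assms(1,2)
proof (induction X u rule: local_search.induct)
  case (1 X u)
  show ?case
  proof (cases "\<exists>w \<in> neighbors u. X w < X u")
    case True
    then obtain w where w: "w \<in> neighbors u" "X w < X u" by blast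
    have set: "set_pmf (pmf_of_set (lightest_neighbors X u)) = lightest_neighbors X u"
      using lightest_neighbors_nonempty[OF w(1)] finite_neighbors
      by (intro set_pmf_of_set) (auto simp: lightest_neighbors_def)
    have "v \<in> set_pmf (bind_pmf (pmf_of_set (lightest_neighbors X u)) (\<lambda>v. local_search X v))"
      using "1.prems"(1) True by (subst (asm) local_search.simps) simp
    then obtain u' where u': "u' \<in> lightest_neighbors X u" "v \<in> set_pmf (local_search X u')"
      using set by auto
    have "X u' < X u" using lightest_neighbors_descent[OF w] u'(1) set by blast
    moreover have n: "u' \<in> neighbors u" using u'(1) unfolding lightest_neighbors_def by simp
    \<comment> \<open>The Lipschitz bound is needed for the reversed arc: \<open>f\<close> must not
      drop by more than 1.\<close>
    moreover have "f u \<le> Suc (f u')" using lipschitz[OF neighbors_sym[OF n]] .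
    moreover have "v \<in> verts G \<and> (\<forall>w \<in> neighbors v. X v \<le> X w) \<and> X v + f u' \<le> X u' + f v"
      using "1.IH"[OF True _ u'(2)] u'(1) set n neighbors_in_verts by blast
    ultimately show ?thesis by auto
  next
    case False
    then have "v = u" using "1.prems"(1) by (subst (asm) local_search.simps) simp
    then show ?thesis using False "1.prems"(2) by (auto simp: not_less)
  qed
qed

definition allocate :: "('a \<Rightarrow> nat) \<Rightarrow> ('a \<Rightarrow> nat) pmf" where
  "allocate X = bind_pmf (pmf_of_set (verts G)) (\<lambda>u.
     map_pmf (\<lambda>v. X(v := X v + 1)) (local_search X u))"

lemma allocation_Suc_allocate: "allocation (Suc i) = bind_pmf (allocation i) allocate"
  by (simp add: allocate_def[abs_def] map_pmf_def)

text \<open>A ball lands at a local minimum, so raising that load by 1 leaves it at most 1 above its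
  neighbours.\<close>

lemma allocation_lipschitz:
  assumes "X \<in> set_pmf (allocation i)" "verts G \<noteq> {}" "w \<in> neighbors u"
  shows "X u \<le> Suc (X w)"
  using assms(1,3)
proof (induction i arbitrary: X u w)
  case (Suc i)
  obtain Y b v where Y: "Y \<in> set_pmf (allocation i)" "b \<in> verts G"
      "v \<in> set_pmf (local_search Y b)" "X = Y(v := Y v + 1)"
    using Suc.prems(1) assms(2) by auto
  have "\<forall>w \<in> neighbors v. Y v \<le> Y w"
    using local_search_landing[OF Y(3,2), of "\<lambda>_. 0"] by auto
  moreover have "Y u \<le> Suc (Y w)" using Suc.IH[OF Y(1)] Suc.prems(2) by blast
  ultimately show ?case using Suc.prems(2) Y(4) by auto
qed simp

lemma allocation_hops:
  assumes "X \<in> set_pmf (allocation i)" "connected G" "v \<in> verts G" "u \<in> verts G"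
  shows "X v \<le> X u + hops v u"
proof -
  have "X v \<le> X u + r" if "u \<in> dist_ball v r" for r
    using that
  proof (induction r arbitrary: u)
    case 0
    then show ?case by (auto elim: dist_ball_last_step)
  next
    case (Suc r)
    show ?case
    proof (cases "u = v")
      case False
      then obtain w where w: "w \<in> dist_ball v r" "u \<in> neighbors w"
        using Suc.prems by (auto elim: dist_ball_last_step)
      have "X w \<le> Suc (X u)"
        using allocation_lipschitz[OF assms(1) _ w(2)] assms(3) by blast
      then show ?thesis using Suc.IH[OF w(1)] by simp
    qed simp
  qed
  then show ?thesis using in_dist_ball_hops[OF assms(2-4)] by simp
qed

section \<open>The potential and its exponential moment\<close>

text \<open>Natural subtraction gives exponent 0 to every \<open>u\<close> with
  \<open>X u \<le> hops v u\<close>. The \<open>- 1\<close>, inside the sum, then removes such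
  vertices and makes the empty configuration have potential 0. The cap \<open>H\<close> bounds the
  effect of a single ball.\<close>

definition potential :: "real \<Rightarrow> nat \<Rightarrow> 'a \<Rightarrow> ('a \<Rightarrow> nat) \<Rightarrow> real" where
  "potential \<kappa> H v X = (\<Sum>u\<in>verts G. \<kappa> ^ min (X u - hops v u) H - 1)"

text \<open>Only the summand at the landing vertex \<open>x\<close> changes. Its excess
  \<open>X x - hops v x\<close> is at most the excess at the birthplace, so the increase is bounded
  by a quantity that depends on \<open>u\<close> but not on the random path.\<close>

lemma potential_landing:
  assumes "connected G" "v \<in> verts G" "u \<in> verts G" "x \<in> set_pmf (local_search X u)"
    and \<kappa>: "\<kappa> \<ge> 1"
  shows "potential \<kappa> H v (X(x := X x + 1)) \<le> potential \<kappa> H v X +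
    (if hops v u \<le> X u then (\<kappa> - 1) * \<kappa> ^ min (X u - hops v u) H else 0)"
proof -
  define e where "e = (if hops v u \<le> X u then (\<kappa> - 1) * \<kappa> ^ min (X u - hops v u) H else 0)"
  have x: "x \<in> verts G" "X x + hops v u \<le> X u + hops v x"
    using local_search_landing[OF assms(4,3), of "hops v"] hops_lipschitz[OF assms(1,2)] by blast+
  have e0: "0 \<le> e" using \<kappa> unfolding e_def by simp
  have *: "\<kappa> ^ min (X x + 1 - hops v x) H \<le> \<kappa> ^ min (X x - hops v x) H + e"
  proof (cases "hops v x \<le> X x \<and> X x - hops v x < H")
    case True
    then have "hops v u \<le> X u" and le: "X x - hops v x \<le> min (X u - hops v u) H"
      using x(2) by linarith+
    have "\<kappa> ^ min (X x + 1 - hops v x) H = \<kappa> ^ Suc (X x - hops v x)"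
      using True by (intro arg_cong[where f = "\<lambda>k. \<kappa> ^ k"]) auto
    also have "\<dots> = \<kappa> ^ (X x - hops v x) + (\<kappa> - 1) * \<kappa> ^ (X x - hops v x)"
      by (simp add: algebra_simps)
    also have "(\<kappa> - 1) * \<kappa> ^ (X x - hops v x) \<le> e"
      using \<open>hops v u \<le> X u\<close> \<kappa> le unfolding e_def
      by (auto intro!: mult_left_mono power_increasing)
    finally show ?thesis using True by simp
  next
    case False
    \<comment> \<open>Either the subtraction yields 0 before and after the ball, or the cap was
      already reached.\<close>
    then have "min (X x + 1 - hops v x) H = min (X x - hops v x) H" by auto
    then show ?thesis using e0 by simp
  qed
  have "potential \<kappa> H v (X(x := X x + 1)) =
      \<kappa> ^ min (X x + 1 - hops v x) H - 1 + (\<Sum>u\<in>verts G - {x}. \<kappa> ^ min (X u - hops v u) H - 1)"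
    unfolding potential_def using x(1) by (subst sum.remove[of _ x]) auto
  also have "\<dots> \<le> e + (\<kappa> ^ min (X x - hops v x) H - 1 +
      (\<Sum>u\<in>verts G - {x}. \<kappa> ^ min (X u - hops v u) H - 1))"
    using * by simp
  also have "\<dots> = potential \<kappa> H v X + e"
    unfolding potential_def using x(1) by (subst (2) sum.remove[of _ x]) auto
  finally show ?thesis unfolding e_def .
qed

text \<open>Averaging \<open>potential_landing\<close> over a uniform birthplace bounds the mean
  increase linearly in the potential itself. In the exponent this costs a factor
  \<open>1 + R\<close> on \<open>\<theta>\<close> and an additive term from the vertices counted by
  \<open>B\<close>.\<close>

lemma nn_integral_allocate_exp_potential:
  fixes \<kappa> \<theta> B :: real
  defines "R \<equiv> 2 * (\<kappa> - 1) / real (card (verts G))"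
  assumes "connected G" "v \<in> verts G"
    and \<kappa>: "\<kappa> \<ge> 1" and \<theta>: "\<theta> \<ge> 0" "\<theta> * ((\<kappa> - 1) * \<kappa> ^ H) \<le> 1"
    and B: "real (card {u \<in> verts G. hops v u \<le> X u}) \<le> B"
  shows "(\<integral>\<^sup>+Y. ennreal (exp (\<theta> * potential \<kappa> H v Y)) \<partial>measure_pmf (allocate X))
    \<le> ennreal (exp (\<theta> * (1 + R) * potential \<kappa> H v X + R * \<theta> * B))"
proof -
  let ?n = "real (card (verts G))"
  let ?\<Phi> = "potential \<kappa> H v"
  define A where "A = {u \<in> verts G. hops v u \<le> X u}"
  define y where "y u = \<theta> * (if hops v u \<le> X u then (\<kappa> - 1) * \<kappa> ^ min (X u - hops v u) H else 0)" for u
  have ne: "verts G \<noteq> {}" using assms by auto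
  then have n: "?n > 0" by (simp add: card_gt_0_iff)
  have y: "0 \<le> y u" "y u \<le> 1" for u
  proof -
    show "0 \<le> y u" using \<kappa> \<theta> unfolding y_def by simp
    have "(\<kappa> - 1) * \<kappa> ^ min (X u - hops v u) H \<le> (\<kappa> - 1) * \<kappa> ^ H"
      using \<kappa> by (intro mult_left_mono power_increasing) auto
    then have "\<theta> * ((\<kappa> - 1) * \<kappa> ^ min (X u - hops v u) H) \<le> 1"
      using \<theta> by (meson mult_left_mono order_trans)
    then show "y u \<le> 1" unfolding y_def by simp
  qed
  have one: "(\<integral>\<^sup>+x. ennreal (exp (\<theta> * ?\<Phi> (X(x := X x + 1)))) \<partial>measure_pmf (local_search X u))
      \<le> ennreal (exp (\<theta> * ?\<Phi> X) * (1 + 2 * y u))" if u: "u \<in> verts G" for u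
  proof -
    have "(\<integral>\<^sup>+x. ennreal (exp (\<theta> * ?\<Phi> (X(x := X x + 1)))) \<partial>measure_pmf (local_search X u))
        \<le> (\<integral>\<^sup>+x. ennreal (exp (\<theta> * ?\<Phi> X) * (1 + 2 * y u)) \<partial>measure_pmf (local_search X u))"
    proof (intro nn_integral_mono_AE AE_pmfI ennreal_leI)
      fix x assume "x \<in> set_pmf (local_search X u)"
      then have "\<theta> * ?\<Phi> (X(x := X x + 1)) \<le> \<theta> * ?\<Phi> X + y u"
        using mult_left_mono[OF potential_landing[OF assms(2,3) u _ \<kappa>] \<theta>(1)]
        unfolding y_def by (simp add: distrib_left)
      then have "exp (\<theta> * ?\<Phi> (X(x := X x + 1))) \<le> exp (\<theta> * ?\<Phi> X) * exp (y u)"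
        by (simp flip: exp_add)
      also have "\<dots> \<le> exp (\<theta> * ?\<Phi> X) * (1 + 2 * y u)"
        using exp_le_one_plus_double[OF y] by simp
      finally show "exp (\<theta> * ?\<Phi> (X(x := X x + 1))) \<le> exp (\<theta> * ?\<Phi> X) * (1 + 2 * y u)" .
    qed
    then show ?thesis by simp
  qed
  have "(\<Sum>u\<in>verts G. y u) = \<theta> * (\<kappa> - 1) * (\<Sum>u\<in>A. \<kappa> ^ min (X u - hops v u) H)"
    unfolding y_def A_def
    by (simp add: sum_distrib_left mult.assoc if_distrib[of "(*) \<theta>"] flip: sum.inter_filter cong: if_cong)
  \<comment> \<open>The powers exceed the summands of the potential by 1 for each vertex of
    \<open>A\<close>; this is where \<open>B\<close> enters.\<close>
  also have "(\<Sum>u\<in>A. \<kappa> ^ min (X u - hops v u) H) = (\<Sum>u\<in>A. \<kappa> ^ min (X u - hops v u) H - 1) + real (card A)"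
    by (simp add: sum_subtractf)
  also have "\<theta> * (\<kappa> - 1) * \<dots> \<le> \<theta> * (\<kappa> - 1) * (?\<Phi> X + B)"
  proof (intro mult_left_mono add_mono)
    show "(\<Sum>u\<in>A. \<kappa> ^ min (X u - hops v u) H - 1) \<le> ?\<Phi> X"
      unfolding potential_def A_def using \<kappa> by (intro sum_mono2) auto
  qed (use B \<kappa> \<theta> in \<open>auto simp: A_def\<close>)
  finally have sum_y: "(\<Sum>u\<in>verts G. y u) \<le> \<theta> * (\<kappa> - 1) * (?\<Phi> X + B)" .
  have "(\<integral>\<^sup>+Y. ennreal (exp (\<theta> * ?\<Phi> Y)) \<partial>measure_pmf (allocate X)) =
      (\<Sum>u\<in>verts G. \<integral>\<^sup>+x. ennreal (exp (\<theta> * ?\<Phi> (X(x := X x + 1)))) \<partial>measure_pmf (local_search X u)) / ?n"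
    using ne unfolding allocate_def by (simp add: nn_integral_pmf_of_set ennreal_of_nat_eq_real_of_nat)
  also have "\<dots> \<le> (\<Sum>u\<in>verts G. ennreal (exp (\<theta> * ?\<Phi> X) * (1 + 2 * y u))) / ?n"
    by (intro divide_right_mono_ennreal sum_mono one)
  also have "\<dots> = ennreal ((\<Sum>u\<in>verts G. exp (\<theta> * ?\<Phi> X) * (1 + 2 * y u)) / ?n)"
    using n y by (subst sum_ennreal) (auto simp: divide_ennreal sum_nonneg)
  also have "(\<Sum>u\<in>verts G. exp (\<theta> * ?\<Phi> X) * (1 + 2 * y u)) = exp (\<theta> * ?\<Phi> X) * (?n + 2 * (\<Sum>u\<in>verts G. y u))"
    by (simp add: sum.distrib flip: sum_distrib_left)
  also have "ennreal (\<dots> / ?n) \<le> ennreal (exp (\<theta> * (1 + R) * ?\<Phi> X + R * \<theta> * B))"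
  proof (rule ennreal_leI)
    have "(?n + 2 * (\<Sum>u\<in>verts G. y u)) / ?n \<le> 1 + R * \<theta> * (?\<Phi> X + B)"
    proof -
      have "(?n + 2 * (\<Sum>u\<in>verts G. y u)) / ?n \<le> (?n + 2 * (\<theta> * (\<kappa> - 1) * (?\<Phi> X + B))) / ?n"
        using sum_y n by (intro divide_right_mono) auto
      also have "\<dots> = 1 + R * \<theta> * (?\<Phi> X + B)"
        using n ne unfolding R_def by (simp add: add_divide_distrib)
      finally show ?thesis .
    qed
    also have "\<dots> \<le> exp (R * \<theta> * (?\<Phi> X + B))" by (rule exp_ge_add_one_self)
    finally have "exp (\<theta> * ?\<Phi> X) * ((?n + 2 * (\<Sum>u\<in>verts G. y u)) / ?n)
        \<le> exp (\<theta> * ?\<Phi> X) * exp (R * \<theta> * (?\<Phi> X + B))"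
      by (rule mult_left_mono) simp
    then show "exp (\<theta> * ?\<Phi> X) * (?n + 2 * (\<Sum>u\<in>verts G. y u)) / ?n
        \<le> exp (\<theta> * (1 + R) * ?\<Phi> X + R * \<theta> * B)"
      by (simp add: algebra_simps flip: exp_add)
  qed
  finally show ?thesis .
qed

lemma allocate_mono:
  assumes "Y \<in> set_pmf (allocate X)" "verts G \<noteq> {}"
  shows "X u \<le> Y u"
  using assms unfolding allocate_def by (auto split: if_splits)

lemma allocate_le_Suc:
  assumes "Y \<in> set_pmf (allocate X)" "verts G \<noteq> {}"
  shows "Y u \<le> Suc (X u)"
  using assms unfolding allocate_def by (auto split: if_splits)

text \<open>The last ball is averaged out first, and each ball replaces \<open>\<theta>\<close> by
  \<open>\<theta> * (1 + R)\<close>; hence the smallness condition on the final value. The additive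
  costs form a geometric series. Restricting to loads at most \<open>L\<close> makes one
  \<open>B\<close> valid at every time.\<close>

lemma nn_integral_allocation_exp_potential:
  fixes \<kappa> \<theta> B :: real
  defines "R \<equiv> 2 * (\<kappa> - 1) / real (card (verts G))"
  assumes "connected G" "v \<in> verts G"
    and \<kappa>: "\<kappa> \<ge> 1" and \<theta>: "\<theta> \<ge> 0" "\<theta> * (1 + R) ^ i * ((\<kappa> - 1) * \<kappa> ^ H) \<le> 1"
    and B: "real (card {u \<in> verts G. hops v u \<le> L}) \<le> B"
  shows "(\<integral>\<^sup>+X. ennreal (exp (\<theta> * potential \<kappa> H v X)) * indicator {X. \<forall>u\<in>verts G. X u \<le> L} X
      \<partial>measure_pmf (allocation i)) \<le> ennreal (exp (((1 + R) ^ i - 1) * \<theta> * B))"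
  using \<theta>
proof (induction i arbitrary: \<theta>)
  case 0
  have "potential \<kappa> H v (\<lambda>_. 0) = 0" unfolding potential_def by simp
  then show ?case by simp
next
  case (Suc i)
  let ?\<Phi> = "potential \<kappa> H v"
  define S where "S = {X. \<forall>u\<in>verts G. X u \<le> L}"
  have ne: "verts G \<noteq> {}" using assms by auto
  have R: "R \<ge> 0" using \<kappa> unfolding R_def by simp
  have "\<theta> * ((\<kappa> - 1) * \<kappa> ^ H) \<le> \<theta> * (1 + R) ^ Suc i * ((\<kappa> - 1) * \<kappa> ^ H)"
  proof -
    have "1 \<le> (1 + R) ^ Suc i" using R by (intro one_le_power) simp
    then have "\<theta> * 1 \<le> \<theta> * (1 + R) ^ Suc i" using Suc.prems(1) by (rule mult_left_mono)
    then show ?thesis using \<kappa> by (intro mult_right_mono) auto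
  qed
  with Suc.prems have small: "\<theta> * ((\<kappa> - 1) * \<kappa> ^ H) \<le> 1" by simp
  have step: "(\<integral>\<^sup>+Y. ennreal (exp (\<theta> * ?\<Phi> Y)) * indicator S Y \<partial>measure_pmf (allocate X))
      \<le> ennreal (exp (R * \<theta> * B)) * (ennreal (exp (\<theta> * (1 + R) * ?\<Phi> X)) * indicator S X)" for X
  proof (cases "X \<in> S")
    case True
    have "card {u \<in> verts G. hops v u \<le> X u} \<le> card {u \<in> verts G. hops v u \<le> L}"
      using True unfolding S_def by (intro card_mono) (auto intro: order_trans)
    then have B': "real (card {u \<in> verts G. hops v u \<le> X u}) \<le> B" using B by linarith
    have "(\<integral>\<^sup>+Y. ennreal (exp (\<theta> * ?\<Phi> Y)) * indicator S Y \<partial>measure_pmf (allocate X))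
        \<le> (\<integral>\<^sup>+Y. ennreal (exp (\<theta> * ?\<Phi> Y)) \<partial>measure_pmf (allocate X))"
      by (intro nn_integral_mono) (simp split: split_indicator)
    also have "\<dots> \<le> ennreal (exp (\<theta> * (1 + R) * ?\<Phi> X + R * \<theta> * B))"
      unfolding R_def
      by (rule nn_integral_allocate_exp_potential[OF assms(2,3) \<kappa> Suc.prems(1) small B'])
    also have "\<dots> = ennreal (exp (R * \<theta> * B)) * ennreal (exp (\<theta> * (1 + R) * ?\<Phi> X))"
      by (simp add: exp_add mult.commute flip: ennreal_mult)
    finally show ?thesis using True by simp
  next
    case False
    \<comment> \<open>Loads never decrease, so a state outside \<open>S\<close> cannot return to
      \<open>S\<close>. This transfers the indicator from \<open>Y\<close> to
      \<open>X\<close>.\<close>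
    have "(\<integral>\<^sup>+Y. ennreal (exp (\<theta> * ?\<Phi> Y)) * indicator S Y \<partial>measure_pmf (allocate X))
        = (\<integral>\<^sup>+Y. 0 \<partial>measure_pmf (allocate X))"
    proof (intro nn_integral_cong_AE AE_pmfI)
      fix Y assume "Y \<in> set_pmf (allocate X)"
      then have "Y \<notin> S" using False allocate_mono[OF _ ne] unfolding S_def by (blast intro: order_trans)
      then show "ennreal (exp (\<theta> * ?\<Phi> Y)) * indicator S Y = 0" by simp
    qed
    then show ?thesis by simp
  qed
  have "(\<integral>\<^sup>+X. ennreal (exp (\<theta> * ?\<Phi> X)) * indicator S X \<partial>measure_pmf (allocation (Suc i)))
      = (\<integral>\<^sup>+X. \<integral>\<^sup>+Y. ennreal (exp (\<theta> * ?\<Phi> Y)) * indicator S Y \<partial>measure_pmf (allocate X) \<partial>measure_pmf (allocation i))"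
    unfolding allocation_Suc_allocate by simp
  also have "\<dots> \<le> (\<integral>\<^sup>+X. ennreal (exp (R * \<theta> * B)) *
      (ennreal (exp (\<theta> * (1 + R) * ?\<Phi> X)) * indicator S X) \<partial>measure_pmf (allocation i))"
    by (intro nn_integral_mono step)
  also have "\<dots> = ennreal (exp (R * \<theta> * B)) *
      (\<integral>\<^sup>+X. ennreal (exp (\<theta> * (1 + R) * ?\<Phi> X)) * indicator S X \<partial>measure_pmf (allocation i))"
    by (rule nn_integral_cmult) simp
  also have "\<dots> \<le> ennreal (exp (R * \<theta> * B)) * ennreal (exp (((1 + R) ^ i - 1) * (\<theta> * (1 + R)) * B))"
    using Suc.IH[of "\<theta> * (1 + R)"] Suc.prems R unfolding S_def
    by (intro mult_left_mono) (simp_all add: mult.assoc)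
  also have "\<dots> = ennreal (exp (((1 + R) ^ Suc i - 1) * \<theta> * B))"
    by (simp add: algebra_simps flip: ennreal_mult exp_add)
  finally show ?case unfolding S_def .
qed

section \<open>Reaching a high load for the first time\<close>

text \<open>Within distance \<open>m\<close> of \<open>v\<close> the load falls by at most
  \<open>m\<close>, and subtracting \<open>hops v u\<close> costs at most another \<open>m\<close>.
  The margin \<open>2 * m\<close> pays for both, so the cap \<open>H\<close> is attained on the
  whole ball.\<close>

lemma potential_ge_of_high_load:
  fixes \<kappa> :: real
  assumes "X \<in> set_pmf (allocation i)" "connected G" "v \<in> verts G"
    and \<kappa>: "\<kappa> \<ge> 1" and load: "H + 2 * m \<le> X v"
  shows "(\<kappa> ^ H - 1) * real (card (dist_ball v m)) \<le> potential \<kappa> H v X"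
proof -
  have "(\<kappa> ^ H - 1) * real (card (dist_ball v m)) = (\<Sum>u\<in>dist_ball v m. \<kappa> ^ H - 1)" by simp
  also have "\<dots> \<le> (\<Sum>u\<in>dist_ball v m. \<kappa> ^ min (X u - hops v u) H - 1)"
  proof (rule sum_mono)
    fix u assume u: "u \<in> dist_ball v m"
    then have "u \<in> verts G" using dist_ball_subset_verts by blast
    then have "X v \<le> X u + hops v u" using allocation_hops assms by blast
    then have "min (X u - hops v u) H = H" using hops_le[OF u] load by linarith
    then show "\<kappa> ^ H - 1 \<le> \<kappa> ^ min (X u - hops v u) H - 1" by simp
  qed
  also have "\<dots> \<le> potential \<kappa> H v X"
    unfolding potential_def using \<kappa> dist_ball_subset_verts by (intro sum_mono2) auto
  finally show ?thesis .
qed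

text \<open>Markov's inequality for the exponential moment, on the event that no load exceeds
  \<open>L\<close>.\<close>

lemma emeasure_allocation_first_hit_le:
  fixes \<kappa> \<theta> B :: real
  defines "R \<equiv> 2 * (\<kappa> - 1) / real (card (verts G))"
  assumes "connected G" "v \<in> verts G"
    and \<kappa>: "\<kappa> \<ge> 1" and \<theta>: "\<theta> \<ge> 0" "\<theta> * (1 + R) ^ i * ((\<kappa> - 1) * \<kappa> ^ H) \<le> 1"
    and B: "real (card {u \<in> verts G. hops v u \<le> L}) \<le> B" and L: "H + 2 * m \<le> L"
  shows "emeasure (measure_pmf (allocation i)) {X. X v = L \<and> (\<forall>u\<in>verts G. X u \<le> L)}
    \<le> ennreal (exp (((1 + R) ^ i - 1) * \<theta> * B - \<theta> * ((\<kappa> ^ H - 1) * real (card (dist_ball v m)))))"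
proof -
  let ?t = "\<theta> * ((\<kappa> ^ H - 1) * real (card (dist_ball v m)))"
  let ?S = "{X. \<forall>u\<in>verts G. X u \<le> L}"
  have "emeasure (measure_pmf (allocation i)) {X. X v = L \<and> (\<forall>u\<in>verts G. X u \<le> L)}
      = (\<integral>\<^sup>+X. indicator {X. X v = L \<and> (\<forall>u\<in>verts G. X u \<le> L)} X \<partial>measure_pmf (allocation i))"
    by simp
  also have "\<dots> \<le> (\<integral>\<^sup>+X. ennreal (exp (- ?t)) * (ennreal (exp (\<theta> * potential \<kappa> H v X)) * indicator ?S X)
      \<partial>measure_pmf (allocation i))"
  proof (intro nn_integral_mono_AE AE_pmfI)
    fix X assume X: "X \<in> set_pmf (allocation i)"
    show "indicator {X. X v = L \<and> (\<forall>u\<in>verts G. X u \<le> L)} X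
        \<le> ennreal (exp (- ?t)) * (ennreal (exp (\<theta> * potential \<kappa> H v X)) * indicator ?S X)"
    proof (cases "X v = L \<and> (\<forall>u\<in>verts G. X u \<le> L)")
      case True
      then have "?t \<le> \<theta> * potential \<kappa> H v X"
        using potential_ge_of_high_load[OF X assms(2,3) \<kappa>, of H m] L \<theta>(1) by (intro mult_left_mono) auto
      then have "ennreal 1 \<le> ennreal (exp (- ?t) * exp (\<theta> * potential \<kappa> H v X))"
        by (intro ennreal_leI) (simp flip: exp_add)
      then show ?thesis using True by (simp add: ennreal_mult)
    qed simp
  qed
  also have "\<dots> = ennreal (exp (- ?t)) * (\<integral>\<^sup>+X. ennreal (exp (\<theta> * potential \<kappa> H v X)) * indicator ?S X
      \<partial>measure_pmf (allocation i))"
    by (rule nn_integral_cmult) simp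
  also have "\<dots> \<le> ennreal (exp (- ?t)) * ennreal (exp (((1 + R) ^ i - 1) * \<theta> * B))"
    using nn_integral_allocation_exp_potential[OF assms(2,3) \<kappa> \<theta>(1) _ B] \<theta>(2)
    unfolding R_def by (intro mult_left_mono) auto
  also have "\<dots> = ennreal (exp (((1 + R) ^ i - 1) * \<theta> * B - ?t))"
    by (simp flip: ennreal_mult exp_add)
  finally show ?thesis .
qed

text \<open>Loads grow by at most 1 per ball, so level \<open>L\<close> is first reached in a state
  where some load equals \<open>L\<close> and none is larger. A union bound over times and vertices
  follows; \<open>L > 0\<close> settles time 0.\<close>

lemma emeasure_allocation_high_load_le:
  assumes ne: "verts G \<noteq> {}" and L: "L > 0"
    and hit: "\<And>i v. i \<le> k \<Longrightarrow> v \<in> verts G \<Longrightarrow>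
      emeasure (measure_pmf (allocation i)) {X. X v = L \<and> (\<forall>u\<in>verts G. X u \<le> L)} \<le> \<epsilon>"
  shows "emeasure (measure_pmf (allocation k)) {X. \<exists>u\<in>verts G. L \<le> X u} \<le> of_nat k * (of_nat (card (verts G)) * \<epsilon>)"
  using hit
proof (induction k)
  case 0
  then show ?case using L by simp
next
  case (Suc k)
  let ?bad = "{X. \<exists>u\<in>verts G. L \<le> X u}"
  let ?hit = "\<Union>v\<in>verts G. {X. X v = L \<and> (\<forall>u\<in>verts G. X u \<le> L)}"
  have step: "emeasure (measure_pmf (allocate X)) ?bad
      \<le> indicator ?bad X + emeasure (measure_pmf (allocate X)) ?hit" for X
  proof (cases "X \<in> ?bad")
    case True
    have "emeasure (measure_pmf (allocate X)) ?bad \<le> 1" by (rule measure_pmf.emeasure_le_1)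
    then show ?thesis using True by (simp add: add_increasing2)
  next
    case False
    have "emeasure (measure_pmf (allocate X)) ?bad \<le> emeasure (measure_pmf (allocate X)) ?hit"
    proof (rule emeasure_mono_AE)
      show "AE Y in measure_pmf (allocate X). Y \<in> ?bad \<longrightarrow> Y \<in> ?hit"
      proof (intro AE_pmfI impI)
        fix Y assume Y: "Y \<in> set_pmf (allocate X)" "Y \<in> ?bad"
        have "Y u \<le> L" if "u \<in> verts G" for u
        proof -
          have "X u < L" using False that by (simp add: not_le)
          then show ?thesis using allocate_le_Suc[OF Y(1) ne, of u] by simp
        qed
        then show "Y \<in> ?hit" using Y(2) by (auto intro: antisym)
      qed
    qed simp
    then show ?thesis using False by simp
  qed
  have "emeasure (measure_pmf (allocation (Suc k))) ?bad
      = (\<integral>\<^sup>+X. emeasure (measure_pmf (allocate X)) ?bad \<partial>measure_pmf (allocation k))"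
    unfolding allocation_Suc_allocate by simp
  also have "\<dots> \<le> (\<integral>\<^sup>+X. indicator ?bad X + emeasure (measure_pmf (allocate X)) ?hit \<partial>measure_pmf (allocation k))"
    by (intro nn_integral_mono step)
  also have "\<dots> = emeasure (measure_pmf (allocation k)) ?bad + emeasure (measure_pmf (allocation (Suc k))) ?hit"
    unfolding allocation_Suc_allocate by (subst nn_integral_add) auto
  also have "emeasure (measure_pmf (allocation (Suc k))) ?hit
      \<le> (\<Sum>v\<in>verts G. emeasure (measure_pmf (allocation (Suc k))) {X. X v = L \<and> (\<forall>u\<in>verts G. X u \<le> L)})"
    by (rule emeasure_subadditive_finite) auto
  also have "\<dots> \<le> (\<Sum>v\<in>verts G. \<epsilon>)" by (intro sum_mono Suc.prems) simp_all
  also have "\<dots> = of_nat (card (verts G)) * \<epsilon>" by simp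
  also have "emeasure (measure_pmf (allocation k)) ?bad \<le> of_nat k * (of_nat (card (verts G)) * \<epsilon>)"
    using Suc by auto
  finally show ?case by (simp add: distrib_right add.commute add_mono)
qed

text \<open>Takes \<open>L = 4 * m\<close> and \<open>H = 2 * m\<close>, so that
  \<open>H + 2 * m = L\<close>. The square in \<open>\<kappa>\<close> makes
  \<open>\<kappa> ^ H\<close> equal to \<open>(\<Delta> + 2) ^ L\<close>, which dominates the ball
  size bound \<open>B\<close>.\<close>

lemma emeasure_allocation_max_load_le:
  fixes \<Delta> :: nat and \<kappa> s :: real
  defines "\<kappa> \<equiv> (real \<Delta> + 2)\<^sup>2"
  assumes "connected G" and degree: "\<And>u. u \<in> verts G \<Longrightarrow> out_degree G u \<le> \<Delta>"
    and m: "m > 0" and s: "\<And>v. v \<in> verts G \<Longrightarrow> s \<le> real (card (dist_ball v m))" "s \<ge> 0"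
    and n: "n = card (verts G)" "n > 0"
  shows "emeasure (measure_pmf (allocation n)) {X. \<exists>u\<in>verts G. 4 * m \<le> X u} \<le>
    ennreal (real n * (real n * exp (1 - s / (2 * (\<kappa> - 1) * exp (2 * (\<kappa> - 1))))))"
proof -
  define R where "R = 2 * (\<kappa> - 1) / real (card (verts G))"
  define q where "q = \<kappa> ^ (2 * m)"
  \<comment> \<open>Chosen to meet the smallness condition up to time \<open>n\<close>, since
    \<open>(1 + R) ^ n\<close> is at most
    \<open>exp (R * n) = exp (2 * (\<kappa> - 1))\<close>.\<close>
  define \<theta> where "\<theta> = 1 / (exp (2 * (\<kappa> - 1)) * ((\<kappa> - 1) * q))"
  define B where "B = (real \<Delta> + 1) ^ (4 * m)"
  have "4 = (2::real)\<^sup>2" by simp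
  also have "\<dots> \<le> \<kappa>" unfolding \<kappa>_def by (intro power_mono) auto
  finally have \<kappa>: "\<kappa> \<ge> 4" .
  have "\<kappa> ^ 1 \<le> q" unfolding q_def using \<kappa> m by (intro power_increasing) auto
  then have q: "q \<ge> 4" using \<kappa> by simp
  have R: "R \<ge> 0" unfolding R_def using \<kappa> by simp
  have \<theta>: "\<theta> > 0" unfolding \<theta>_def using \<kappa> q by simp
  have Bq: "B \<le> q"
  proof -
    have "B \<le> (real \<Delta> + 2) ^ (4 * m)" unfolding B_def by (intro power_mono) auto
    also have "\<dots> = q" unfolding q_def \<kappa>_def by (simp flip: power_mult)
    finally show ?thesis .
  qed
  have B0: "B \<ge> 0" unfolding B_def by simp
  have ne: "verts G \<noteq> {}" using n by auto
  have hit: "emeasure (measure_pmf (allocation i)) {X. X v = 4 * m \<and> (\<forall>u\<in>verts G. X u \<le> 4 * m)}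
      \<le> ennreal (exp (1 - s / (2 * (\<kappa> - 1) * exp (2 * (\<kappa> - 1)))))"
    if "i \<le> n" "v \<in> verts G" for i v
  proof -
    have "(1 + R) ^ i \<le> (1 + R) ^ n" using that R by (intro power_increasing) auto
    also have "\<dots> \<le> exp R ^ n" using R by (intro power_mono exp_ge_add_one_self) auto
    also have "\<dots> = exp (2 * (\<kappa> - 1))"
      using n ne unfolding R_def by (simp flip: exp_of_nat_mult)
    finally have Ri: "(1 + R) ^ i \<le> exp (2 * (\<kappa> - 1))" .
    have "\<theta> * (1 + R) ^ i * ((\<kappa> - 1) * q) \<le> \<theta> * exp (2 * (\<kappa> - 1)) * ((\<kappa> - 1) * q)"
      using Ri \<theta> \<kappa> q by (intro mult_right_mono mult_left_mono) auto
    also have "\<dots> = 1" unfolding \<theta>_def using \<kappa> q by simp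
    finally have small: "\<theta> * (1 + R) ^ i * ((\<kappa> - 1) * \<kappa> ^ (2 * m)) \<le> 1" unfolding q_def .
    have "card {u \<in> verts G. hops v u \<le> 4 * m} \<le> (\<Delta> + 1) ^ (4 * m)"
      using assms(2) that(2) degree by (rule card_hops_le)
    then have "real (card {u \<in> verts G. hops v u \<le> 4 * m}) \<le> real ((\<Delta> + 1) ^ (4 * m))"
      by (simp only: of_nat_le_iff)
    also have "\<dots> = B"
      unfolding B_def of_nat_power of_nat_add of_nat_1 ..
    finally have card_B: "real (card {u \<in> verts G. hops v u \<le> 4 * m}) \<le> B" .
    have "emeasure (measure_pmf (allocation i)) {X. X v = 4 * m \<and> (\<forall>u\<in>verts G. X u \<le> 4 * m)}
        \<le> ennreal (exp (((1 + R) ^ i - 1) * \<theta> * B - \<theta> * ((q - 1) * real (card (dist_ball v m)))))"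
      using emeasure_allocation_first_hit_le[OF assms(2) that(2), of \<kappa> \<theta> i "2 * m" "4 * m" B m]
        \<kappa> \<theta> small card_B unfolding R_def q_def by auto
    also have "\<dots> \<le> ennreal (exp (1 - s / (2 * (\<kappa> - 1) * exp (2 * (\<kappa> - 1)))))"
    proof (intro ennreal_leI exp_le_cancel_iff[THEN iffD2] diff_mono)
      \<comment> \<open>As \<open>B \<le> q\<close>, the factor \<open>1 / q\<close> in
        \<open>\<theta>\<close> cancels the ball size, leaving a constant.\<close>
      have "((1 + R) ^ i - 1) * \<theta> * B \<le> exp (2 * (\<kappa> - 1)) * \<theta> * q"
        using Ri Bq B0 \<theta> R by (intro mult_mono) auto
      also have "\<dots> = 1 / (\<kappa> - 1)" unfolding \<theta>_def using q \<kappa> by simp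
      also have "\<dots> \<le> 1" using \<kappa> by simp
      finally show "((1 + R) ^ i - 1) * \<theta> * B \<le> 1" .
      \<comment> \<open>Here \<open>q \<ge> 4\<close> gives \<open>q / 2 \<le> q - 1\<close>, and
        \<open>q\<close> cancels against \<open>\<theta>\<close>.\<close>
      have "s / (2 * (\<kappa> - 1) * exp (2 * (\<kappa> - 1))) = \<theta> * (q / 2 * s)"
        unfolding \<theta>_def using q \<kappa> by (simp add: field_simps)
      also have "\<dots> \<le> \<theta> * ((q - 1) * real (card (dist_ball v m)))"
        using \<theta> q s that(2) by (intro mult_left_mono mult_mono) auto
      finally show "s / (2 * (\<kappa> - 1) * exp (2 * (\<kappa> - 1))) \<le> \<theta> * ((q - 1) * real (card (dist_ball v m)))" .
    qed
    finally show ?thesis .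
  qed
  have "emeasure (measure_pmf (allocation n)) {X. \<exists>u\<in>verts G. 4 * m \<le> X u}
      \<le> of_nat n * (of_nat (card (verts G)) * ennreal (exp (1 - s / (2 * (\<kappa> - 1) * exp (2 * (\<kappa> - 1))))))"
    using m hit by (intro emeasure_allocation_high_load_le[OF ne]) auto
  then show ?thesis
    using n by (simp add: ennreal_of_nat_eq_real_of_nat ennreal_mult)
qed

end

section \<open>Asymptotics in the number of vertices\<close>

theorem theorem3p1:
  fixes G :: "nat \<Rightarrow> ('a, 'b) pre_digraph"
    and N :: "nat set"
    and \<Delta> :: nat
    and \<phi> :: real
  assumes graph: "\<And>n. n \<in> N \<Longrightarrow> Digraph.graph (G n)"
    and size: "\<And>n. n \<in> N \<Longrightarrow> card (verts (G n)) = n"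
    and connected: "\<And>n. n \<in> N \<Longrightarrow> Digraph_Component.connected (G n)"
    and bounded_degree: "\<And>n u. n \<in> N \<Longrightarrow> u \<in> verts (G n) \<Longrightarrow> out_degree (G n) u \<le> \<Delta>"
    and \<phi>_pos: "\<phi> > 0"
    and exp_growth: "\<And>n u r. n \<in> N \<Longrightarrow> u \<in> verts (G n) \<Longrightarrow>
      real (card (graph.dist_ball (G n) u r)) \<ge> min (exp (\<phi> * real r)) (real n / 2)"
  shows "\<exists>C::real. C > 0 \<and> (\<forall>K::real. K > 0 \<longrightarrow>
    (\<forall>\<^sub>F n in sequentially. n \<in> N \<longrightarrow>
      measure_pmf.prob (graph.allocation (G n) n)
        {X. real (graph.max_load (G n) X) \<ge> C * ln (ln (real n))} \<le> real n powr (- K)))"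
proof (intro exI conjI allI impI)
  \<comment> \<open>The threshold is \<open>4 * m\<close> with \<open>m\<close> equal to
    \<open>2 / \<phi> * ln (ln n)\<close> rounded up. Rounding adds at most 4 in total, hence at
    most \<open>4 * ln (ln n)\<close> once \<open>ln (ln n) \<ge> 1\<close>.\<close>
  show "8 / \<phi> + 4 > 0" using \<phi>_pos by (simp add: add_pos_pos)
  fix K :: real
  define \<gamma> where "\<gamma> = 1 / (2 * ((real \<Delta> + 2)\<^sup>2 - 1) * exp (2 * ((real \<Delta> + 2)\<^sup>2 - 1)))"
  have "(1::real) < (real \<Delta> + 2)\<^sup>2" by (intro one_less_power) auto
  then have \<gamma>: "\<gamma> > 0" unfolding \<gamma>_def by simp
  have "filterlim (\<lambda>n. ln (real n)) at_top sequentially" by real_asymp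
  \<comment> \<open>Of the 3, two pay for the factors \<open>n\<close> of the union bound and one
    for the constant 1 in the exponent; \<open>K\<close> is the target.\<close>
  then have "\<forall>\<^sub>F n in sequentially. ln (real n) \<ge> (K + 3) / \<gamma>"
    by (simp add: filterlim_at_top)
  \<comment> \<open>Keeps the \<open>n / 2\<close> alternative of the growth hypothesis from
    spoiling the bound on the ball of radius \<open>m\<close>.\<close>
  moreover have "\<forall>\<^sub>F n in sequentially. (ln (real n))\<^sup>2 \<le> real n / 2" by real_asymp
  moreover have "\<forall>\<^sub>F n in sequentially. ln (ln (real n)) \<ge> 1" by real_asymp
  moreover have "\<forall>\<^sub>F n in sequentially. ln (real n) \<ge> 1" by real_asymp
  ultimately show "\<forall>\<^sub>F n in sequentially. n \<in> N \<longrightarrow>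
      measure_pmf.prob (graph.allocation (G n) n)
        {X. real (graph.max_load (G n) X) \<ge> (8 / \<phi> + 4) * ln (ln (real n))} \<le> real n powr (- K)"
  proof (eventually_elim, intro impI)
    case (elim n)
    assume nN: "n \<in> N"
    interpret graph "G n" using graph nN .
    define m where "m = nat \<lceil>2 / \<phi> * ln (ln (real n))\<rceil>"
    have n: "n > 0" using elim(4) by (cases n) auto
    have ne: "verts (G n) \<noteq> {}" using n size[OF nN] by auto
    have m_ge: "2 / \<phi> * ln (ln (real n)) \<le> real m"
      unfolding m_def by linarith
    have "0 < 2 / \<phi> * ln (ln (real n))" using elim(3) \<phi>_pos by simp
    then have m: "m > 0" and m_le: "real m \<le> 2 / \<phi> * ln (ln (real n)) + 1"
      unfolding m_def by linarith+
    have growth: "(ln (real n))\<^sup>2 \<le> real (card (dist_ball v m))" if "v \<in> verts (G n)" for v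
    proof -
      have "(ln (real n))\<^sup>2 = exp (2 * ln (ln (real n)))"
        using elim(4) by (simp add: exp_double)
      also have "\<dots> \<le> exp (\<phi> * real m)"
        using m_ge \<phi>_pos by (simp add: field_simps)
      finally show ?thesis
        using exp_growth[OF nN that, of m] elim(2) by linarith
    qed
    have "{X. real (max_load X) \<ge> (8 / \<phi> + 4) * ln (ln (real n))} \<subseteq> {X. \<exists>u\<in>verts (G n). 4 * m \<le> X u}"
    proof safe
      fix X assume X: "(8 / \<phi> + 4) * ln (ln (real n)) \<le> real (max_load X)"
      have "max_load X \<in> X ` verts (G n)"
        unfolding max_load_def using ne by (intro Max_in) auto
      then obtain u where u: "u \<in> verts (G n)" "max_load X = X u" by auto
      have "real (4 * m) \<le> 4 * (2 / \<phi> * ln (ln (real n)) + ln (ln (real n)))"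
        using m_le elim(3) by simp
      also have "\<dots> = (8 / \<phi> + 4) * ln (ln (real n))" by (simp add: algebra_simps)
      also have "\<dots> \<le> real (X u)" using X u(2) by simp
      finally show "\<exists>u\<in>verts (G n). 4 * m \<le> X u" using u(1) by (auto simp only: of_nat_le_iff)
    qed
    then have "emeasure (measure_pmf (allocation n)) {X. real (max_load X) \<ge> (8 / \<phi> + 4) * ln (ln (real n))}
        \<le> emeasure (measure_pmf (allocation n)) {X. \<exists>u\<in>verts (G n). 4 * m \<le> X u}"
      by (rule emeasure_mono) simp
    also have "\<dots> \<le> ennreal (real n * (real n * exp (1 - \<gamma> * (ln (real n))\<^sup>2)))"
      using emeasure_allocation_max_load_le[OF connected[OF nN] bounded_degree[OF nN] m growth _ _ n]
        size[OF nN] unfolding \<gamma>_def by simp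
    also have "\<dots> \<le> ennreal (real n powr (- K))"
    proof (rule ennreal_leI)
      have "(K + 3) * ln (real n) \<le> \<gamma> * ln (real n) * ln (real n)"
        using elim(1,4) \<gamma> by (intro mult_right_mono) (auto simp: field_simps)
      then have "ln (real n) + (ln (real n) + (1 - \<gamma> * (ln (real n))\<^sup>2)) \<le> - K * ln (real n)"
        using elim(4) by (simp add: power2_eq_square algebra_simps)
      then have "exp (ln (real n) + (ln (real n) + (1 - \<gamma> * (ln (real n))\<^sup>2))) \<le> exp (- K * ln (real n))"
        by simp
      then show "real n * (real n * exp (1 - \<gamma> * (ln (real n))\<^sup>2)) \<le> real n powr - K"
        using n by (simp only: exp_add exp_ln of_nat_0_less_iff powr_def) simp
    qed
    finally show "measure_pmf.prob (allocation n)
        {X. real (max_load X) \<ge> (8 / \<phi> + 4) * ln (ln (real n))} \<le> real n powr (- K)"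
      by (simp add: measure_pmf.emeasure_eq_measure)
  qed
qed

end
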